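(* Let $\delta\in(0,1/2)$, and suppose that $\theta_1,\theta_2\in\Theta$, $P_1\in\mathcal{P}_{\theta_1}$ and $P_2\in\mathcal{P}_{\theta_2}$ satisfy $\mathrm{TV}(P_1,P_2)<1-2\delta$. Then, writing $\eta:=d(\theta_1,\theta_2)/2$, we have $\mathcal{M}_-(\delta)\ge g(\eta)$.
   Context: Setting: $(\Theta,d)$ is a non-empty pseudo-metric space (i.e. $d:\Theta\times\Theta\to[0,\infty)$ is symmetric, satisfies $d(\theta,\theta)=0$ and the triangle inequality, but $d(\theta_1,\theta_2)=0$ is allowed for $\theta_1\ne\theta_2$), equipped with the topology induced by the open balls of $d$ and the corresponding Borel $\sigma$-algebra. For each $\theta\in\Theta$, $\mathcal{P}_\theta$ is a family of probability measures on a measurable space $(\mathcal{X},\mathcal{A})$, and $\mathcal{P}_\Theta:=\{\mathcal{P}_\theta:\theta\in\Theta\}$. The function $g:[0,\infty)\to[0,\infty)$ is increasing (non-decreasing) and the loss is $L(\theta_1,\theta_2):=g(d(\theta_1,\theta_2))$. $\hat\Theta$ is the set of all measurable functions (estimators) from $\mathcal{X}$ to $\Theta$. Lower minimax $(1-\delta)$th quantile: $\mathcal{M}_-(\delta):=\inf\{r\in[0,\infty):\inf_{\hat\theta\in\hat\Theta}\sup_{\theta\in\Theta}\sup_{P_\theta\in\mathcal{P}_\theta}P_\theta\{L(\hat\theta,\theta)>r\}\le\delta\}$. $\mathrm{TV}(P,Q)=\sup_{A\in\mathcal{A}}|P(A)-Q(A)|$ is total variation distance. *)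

theory Defs
  imports "HOL-Probability.Probability_Measure"
begin

locale pseudo_metric_space =
  fixes \<Theta> :: "'a set" and d :: "'a \<Rightarrow> 'a \<Rightarrow> real"
  assumes nonempty: "\<Theta> \<noteq> {}"
    and nonneg: "\<lbrakk>x \<in> \<Theta>; y \<in> \<Theta>\<rbrakk> \<Longrightarrow> 0 \<le> d x y"
    and refl_zero: "x \<in> \<Theta> \<Longrightarrow> d x x = 0"
    and commute: "\<lbrakk>x \<in> \<Theta>; y \<in> \<Theta>\<rbrakk> \<Longrightarrow> d x y = d y x"
    and triangle: "\<lbrakk>x \<in> \<Theta>; y \<in> \<Theta>; z \<in> \<Theta>\<rbrakk> \<Longrightarrow> d x z \<le> d x y + d y z"

definition pm_ball :: "'a set \<Rightarrow> ('a \<Rightarrow> 'a \<Rightarrow> real) \<Rightarrow> 'a \<Rightarrow> real \<Rightarrow> 'a set" where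
  "pm_ball \<Theta> d x r = {y \<in> \<Theta>. d x y < r}"

definition pm_topology :: "'a set \<Rightarrow> ('a \<Rightarrow> 'a \<Rightarrow> real) \<Rightarrow> 'a topology" where
  "pm_topology \<Theta> d = topology_generated_by {pm_ball \<Theta> d x r |x r. x \<in> \<Theta>}"

definition pm_borel :: "'a set \<Rightarrow> ('a \<Rightarrow> 'a \<Rightarrow> real) \<Rightarrow> 'a measure" where
  "pm_borel \<Theta> d = sigma \<Theta> {U. openin (pm_topology \<Theta> d) U}"

definition estimators :: "'x measure \<Rightarrow> 'a set \<Rightarrow> ('a \<Rightarrow> 'a \<Rightarrow> real) \<Rightarrow> ('x \<Rightarrow> 'a) set" where
  "estimators M \<Theta> d = M \<rightarrow>\<^sub>M pm_borel \<Theta> d"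

definition loss :: "(real \<Rightarrow> real) \<Rightarrow> ('a \<Rightarrow> 'a \<Rightarrow> real) \<Rightarrow> 'a \<Rightarrow> 'a \<Rightarrow> real" where
  "loss g d \<theta>\<^sub>1 \<theta>\<^sub>2 = g (d \<theta>\<^sub>1 \<theta>\<^sub>2)"

text \<open>The values lie in the extended nonnegative reals, so that the infimum is infinite
  when no level \<open>r\<close> is admissible, and a supremum over an empty family of measures is 0.\<close>

definition lower_minimax_quantile ::
  "'x measure \<Rightarrow> 'a set \<Rightarrow> ('a \<Rightarrow> 'a \<Rightarrow> real) \<Rightarrow> (real \<Rightarrow> real) \<Rightarrow> ('a \<Rightarrow> 'x measure set)
    \<Rightarrow> real \<Rightarrow> ennreal" where
  "lower_minimax_quantile M \<Theta> d g \<P> \<delta> =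
    Inf (ennreal ` {r. 0 \<le> r \<and>
      (INF T \<in> estimators M \<Theta> d. SUP \<theta> \<in> \<Theta>. SUP Q \<in> \<P> \<theta>.
        emeasure Q {x \<in> space M. loss g d (T x) \<theta> > r}) \<le> ennreal \<delta>})"

text \<open>Meant for probability measures on the same \<open>\<sigma>\<close>-algebra.\<close>

definition total_variation :: "'x measure \<Rightarrow> 'x measure \<Rightarrow> real" where
  "total_variation P Q = (SUP A \<in> sets P. \<bar>measure P A - measure Q A\<bar>)"

end

theory Submission
  imports Defs
begin

text \<open>
  Le Cam's two-point argument: if \<open>r < g \<eta>\<close> then, by the triangle inequality, an estimate cannot have
  loss at most \<open>r\<close> at both \<open>\<theta>\<^sub>1\<close> and \<open>\<theta>\<^sub>2\<close>. So the two error events cover the sample space, and one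
  of them has probability at least \<open>(1 - TV) / 2 > \<delta>\<close> under the corresponding measure. This bound is
  uniform in the estimator, hence such an \<open>r\<close> is not admissible in the quantile.
\<close>

lemma space_pm_borel [simp]: "space (pm_borel \<Theta> d) = \<Theta>"
  by (simp add: pm_borel_def space_measure_of_conv)

lemma openin_pm_topology_subset: "openin (pm_topology \<Theta> d) U \<Longrightarrow> U \<subseteq> \<Theta>"
  using openin_subset[of "pm_topology \<Theta> d" U]
  by (auto simp: pm_topology_def pm_ball_def)

lemma pm_ball_in_sets_pm_borel:
  assumes "x \<in> \<Theta>"
  shows "pm_ball \<Theta> d x r \<in> sets (pm_borel \<Theta> d)"
proof -
  have "openin (pm_topology \<Theta> d) (pm_ball \<Theta> d x r)"
    unfolding pm_topology_def using assms by (intro topology_generated_by_Basis) auto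
  moreover have "{U. openin (pm_topology \<Theta> d) U} \<subseteq> Pow \<Theta>"
    using openin_pm_topology_subset by auto
  ultimately show ?thesis
    by (auto simp: pm_borel_def intro: sigma_sets.Basic)
qed

text \<open>With one argument fixed, the strict sublevel sets are by symmetry exactly the open balls
  around \<open>\<theta>\<close>, and these generate the topology.\<close>

lemma (in pseudo_metric_space) borel_measurable_dist:
  assumes "\<theta> \<in> \<Theta>"
  shows "(\<lambda>x. d x \<theta>) \<in> borel_measurable (pm_borel \<Theta> d)"
proof (rule borel_measurableI_less)
  fix y
  have "{x \<in> space (pm_borel \<Theta> d). d x \<theta> < y} = pm_ball \<Theta> d \<theta> y"
    using commute assms by (auto simp: pm_ball_def)
  then show "{x \<in> space (pm_borel \<Theta> d). d x \<theta> < y} \<in> sets (pm_borel \<Theta> d)"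
    using pm_ball_in_sets_pm_borel[OF assms] by simp
qed

text \<open>Needed because \<open>emeasure\<close> is 0 on non-measurable sets, where no lower bound
  on the risk could hold. A monotone function is Borel, so the loss is a measurable function of the
  distance.\<close>

lemma (in pseudo_metric_space) loss_exceeds_in_sets:
  assumes g: "mono_on {0..} g" and T: "T \<in> estimators M \<Theta> d" and \<theta>: "\<theta> \<in> \<Theta>"
  shows "{x \<in> space M. loss g d (T x) \<theta> > r} \<in> sets M"
proof -
  have T': "T \<in> M \<rightarrow>\<^sub>M pm_borel \<Theta> d"
    using T by (simp add: estimators_def)
  \<comment> \<open>Monotonicity of \<open>g\<close> is known only on the half-line. Truncating the
    argument at 0 extends it to all reals and changes nothing at distances, which are
    nonnegative.\<close>
  have "mono (\<lambda>t. g (max 0 t))"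
    by (rule monoI, rule mono_onD[OF g]) auto
  then have [measurable]: "(\<lambda>t. g (max 0 t)) \<in> borel_measurable borel"
    by (rule borel_measurable_mono)
  have [measurable]: "(\<lambda>x. d (T x) \<theta>) \<in> borel_measurable M"
    using measurable_compose[OF T' borel_measurable_dist[OF \<theta>]] .
  have "{x \<in> space M. g (max 0 (d (T x) \<theta>)) > r} \<in> sets M"
    by measurable
  moreover have "max 0 (d (T x) \<theta>) = d (T x) \<theta>" if "x \<in> space M" for x
    using nonneg[OF _ \<theta>] measurable_space[OF T' that] by simp
  ultimately show ?thesis
    by (simp add: loss_def cong: conj_cong)
qed

text \<open>A supremum of reals dominates its members only if they are bounded above; for
  probabilities the bound is 1.\<close>

lemma total_variation_upper:
  assumes "prob_space P" "prob_space Q" and A: "A \<in> sets P"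
  shows "\<bar>measure P A - measure Q A\<bar> \<le> total_variation P Q"
proof -
  interpret P: prob_space P by fact
  interpret Q: prob_space Q by fact
  have "\<bar>measure P B - measure Q B\<bar> \<le> 1" for B
    using P.prob_le_1[of B] Q.prob_le_1[of B] measure_nonneg[of P B] measure_nonneg[of Q B]
    by linarith
  then show ?thesis
    unfolding total_variation_def
    by (intro cSUP_upper[OF A] bdd_aboveI2[where M = 1])
qed

text \<open>Under \<open>Q\<close> alone the cover gives total mass at least 1; replacing
  \<open>Q\<close> by \<open>P\<close> on \<open>A\<close> costs at most the total
  variation.\<close>

lemma two_point_bound:
  assumes P: "prob_space P" and Q: "prob_space Q" and sets: "sets P = sets Q"
    and A: "A \<in> sets P" and B: "B \<in> sets P" and cover: "space P \<subseteq> A \<union> B"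
  shows "1 - total_variation P Q \<le> measure P A + measure Q B"
proof -
  interpret Q: prob_space Q by fact
  have "space P = space Q"
    using sets by (rule sets_eq_imp_space_eq)
  with cover have "1 \<le> measure Q (A \<union> B)"
    using Q.finite_measure_mono[of "space Q" "A \<union> B"] A B sets by (simp add: Q.prob_space)
  also have "\<dots> \<le> measure Q A + measure Q B"
    using A B sets by (intro measure_Un_le) auto
  finally show ?thesis
    using total_variation_upper[OF P Q A] by linarith
qed

text \<open>The distances from \<open>t\<close> to the two points sum to at least
  \<open>d \<theta>\<^sub>1 \<theta>\<^sub>2\<close>, so one of them is at least half of it, and
  \<open>g\<close> preserves this. The strict inequality comes from \<open>r\<close>, not from the
  distances.\<close>

lemma (in pseudo_metric_space) loss_exceeds_at_one_of_two:
  assumes g: "mono_on {0..} g"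
    and in_\<Theta>: "\<theta>\<^sub>1 \<in> \<Theta>" "\<theta>\<^sub>2 \<in> \<Theta>" "t \<in> \<Theta>"
    and r: "r < g (d \<theta>\<^sub>1 \<theta>\<^sub>2 / 2)"
  shows "r < loss g d t \<theta>\<^sub>1 \<or> r < loss g d t \<theta>\<^sub>2"
proof -
  have "d \<theta>\<^sub>1 \<theta>\<^sub>2 / 2 \<le> d t \<theta>\<^sub>1 \<or> d \<theta>\<^sub>1 \<theta>\<^sub>2 / 2 \<le> d t \<theta>\<^sub>2"
    using triangle[of \<theta>\<^sub>1 t \<theta>\<^sub>2] commute[of \<theta>\<^sub>1 t] in_\<Theta> by auto
  moreover have "r < loss g d t \<theta>" if "\<theta> \<in> \<Theta>" "d \<theta>\<^sub>1 \<theta>\<^sub>2 / 2 \<le> d t \<theta>" for \<theta>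
    using mono_onD[OF g, of "d \<theta>\<^sub>1 \<theta>\<^sub>2 / 2" "d t \<theta>"] nonneg in_\<Theta> r that
    by (force simp: loss_def)
  ultimately show ?thesis
    using in_\<Theta> by blast
qed

theorem lemma5:
  fixes \<Theta> :: "'a set" and d :: "'a \<Rightarrow> 'a \<Rightarrow> real"
    and M :: "'x measure" and \<P> :: "'a \<Rightarrow> 'x measure set"
    and g :: "real \<Rightarrow> real" and \<delta> \<eta> :: real
    and \<theta>\<^sub>1 \<theta>\<^sub>2 :: 'a and P\<^sub>1 P\<^sub>2 :: "'x measure"
  assumes "pseudo_metric_space \<Theta> d"
    and "\<And>\<theta> Q. \<lbrakk>\<theta> \<in> \<Theta>; Q \<in> \<P> \<theta>\<rbrakk> \<Longrightarrow> prob_space Q \<and> sets Q = sets M"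
    and "\<And>t. 0 \<le> t \<Longrightarrow> 0 \<le> g t"
    and "mono_on {0..} g"
    and "0 < \<delta>" and "\<delta> < 1 / 2"
    and "\<theta>\<^sub>1 \<in> \<Theta>" and "\<theta>\<^sub>2 \<in> \<Theta>"
    and "P\<^sub>1 \<in> \<P> \<theta>\<^sub>1" and "P\<^sub>2 \<in> \<P> \<theta>\<^sub>2"
    and "total_variation P\<^sub>1 P\<^sub>2 < 1 - 2 * \<delta>"
    and "\<eta> = d \<theta>\<^sub>1 \<theta>\<^sub>2 / 2"
  shows "lower_minimax_quantile M \<Theta> d g \<P> \<delta> \<ge> ennreal (g \<eta>)"
proof -
  interpret pseudo_metric_space \<Theta> d by fact
  have P: "prob_space P\<^sub>1" "prob_space P\<^sub>2" and sets: "sets P\<^sub>1 = sets M" "sets P\<^sub>2 = sets M"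
    using assms(2,7-10) by auto
  interpret P1: prob_space P\<^sub>1 by fact
  interpret P2: prob_space P\<^sub>2 by fact
  have space: "space P\<^sub>1 = space M"
    using sets(1) by (rule sets_eq_imp_space_eq)
  let ?E = "\<lambda>T \<theta> r. {x \<in> space M. loss g d (T x) \<theta> > r}"
  let ?risk = "\<lambda>r T. SUP \<theta> \<in> \<Theta>. SUP Q \<in> \<P> \<theta>. emeasure Q (?E T \<theta> r)"
  \<comment> \<open>Half of the two-point bound. It does not depend on the estimator, so the strict
    gap above \<delta> survives the infimum over estimators; a risk above \<delta> for each
    estimator separately would not suffice.\<close>
  define c where "c = (1 - total_variation P\<^sub>1 P\<^sub>2) / 2"
  have c: "\<delta> < c"
    using assms(11) by (simp add: c_def)
  have risk: "ennreal c \<le> ?risk r T" if r: "r < g \<eta>" and T: "T \<in> estimators M \<Theta> d" for r T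
  proof -
    have in_sets: "?E T \<theta>\<^sub>1 r \<in> sets P\<^sub>1" "?E T \<theta>\<^sub>2 r \<in> sets P\<^sub>1"
      unfolding sets by (intro loss_exceeds_in_sets[OF assms(4) T] assms(7,8))+
    have "T \<in> M \<rightarrow>\<^sub>M pm_borel \<Theta> d"
      using T by (simp add: estimators_def)
    then have "T x \<in> \<Theta>" if "x \<in> space M" for x
      using measurable_space[OF _ that] by (metis space_pm_borel)
    then have "r < loss g d (T x) \<theta>\<^sub>1 \<or> r < loss g d (T x) \<theta>\<^sub>2" if "x \<in> space M" for x
      using loss_exceeds_at_one_of_two[OF assms(4,7,8)] r assms(12) that by simp
    then have "space P\<^sub>1 \<subseteq> ?E T \<theta>\<^sub>1 r \<union> ?E T \<theta>\<^sub>2 r"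
      unfolding space by blast
    then have "2 * c \<le> measure P\<^sub>1 (?E T \<theta>\<^sub>1 r) + measure P\<^sub>2 (?E T \<theta>\<^sub>2 r)"
      using two_point_bound[OF P _ in_sets] sets by (simp add: c_def)
    then consider "c \<le> measure P\<^sub>1 (?E T \<theta>\<^sub>1 r)" | "c \<le> measure P\<^sub>2 (?E T \<theta>\<^sub>2 r)"
      by linarith
    then show ?thesis
    proof cases
      case 1
      then have "ennreal c \<le> emeasure P\<^sub>1 (?E T \<theta>\<^sub>1 r)"
        by (simp add: P1.emeasure_eq_measure ennreal_leI)
      then show ?thesis
        by (intro SUP_upper2[OF assms(7)] SUP_upper2[OF assms(9)])
    next
      case 2
      then have "ennreal c \<le> emeasure P\<^sub>2 (?E T \<theta>\<^sub>2 r)"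
        by (simp add: P2.emeasure_eq_measure ennreal_leI)
      then show ?thesis
        by (intro SUP_upper2[OF assms(8)] SUP_upper2[OF assms(10)])
    qed
  qed
  have "g \<eta> \<le> r" if "(INF T \<in> estimators M \<Theta> d. ?risk r T) \<le> ennreal \<delta>" for r
  proof (rule ccontr)
    assume "\<not> g \<eta> \<le> r"
    then have "ennreal c \<le> (INF T \<in> estimators M \<Theta> d. ?risk r T)"
      using risk by (intro INF_greatest) simp
    also note that
    \<comment> \<open>Since \<open>ennreal\<close> sends negative reals to 0, \<delta> \<ge> 0 is
      what turns the inequality between \<open>ennreal c\<close> and \<open>ennreal \<delta>\<close>
      into c \<le> \<delta>.\<close>
    finally show False
      using c assms(5) by simp
  qed
  \<comment> \<open>A lower bound on all admissible levels suffices, even if there are none, as the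
    infimum is then infinite.\<close>
  then show ?thesis
    unfolding lower_minimax_quantile_def by (intro Inf_greatest) (auto intro: ennreal_leI)
qed

end
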